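(* Let $q=2^m$ with $m$ an odd positive integer, and let $d=3q$. Then \[AC(d,2)\ \ge\ \frac{4}{9}d^2.\]
   Context: For a group $G$ and a subset $S\subseteq G$ with $S^{-1}=S$ and $e\notin S$, the Cayley graph $\Gamma(G,S)$ has vertex set $G$, with distinct $g,h$ adjacent iff $g^{-1}h\in S$; it is $\#S$-regular. $AC(d,k)$ denotes the largest order of a Cayley graph $\Gamma(G,S)$ with $G$ abelian, of valency (degree) $d$ and diameter $k$. *)

theory Defs
  imports "HOL-Algebra.Coset" "HOL-Algebra.Weak_Morphisms" "Graph_Theory.Graph_Theory"
begin

definition connection_set :: "('a, 'b) monoid_scheme \<Rightarrow> 'a set \<Rightarrow> bool" where
  "connection_set G S \<longleftrightarrow> S \<subseteq> carrier G \<and> m_inv G ` S = S \<and> \<one>\<^bsub>G\<^esub> \<notin> S"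

text \<open>
  In Graph_Theory an undirected simple graph is a \<^locale>\<open>pair_graph\<close>: a finite, loop-free digraph
  with symmetric arc relation.
\<close>

definition cayley_graph :: "('a, 'b) monoid_scheme \<Rightarrow> 'a set \<Rightarrow> 'a pair_pre_digraph" where
  "cayley_graph G S =
     \<lparr>pverts = carrier G,
      parcs = {(g, h). g \<in> carrier G \<and> h \<in> carrier G \<and> inv\<^bsub>G\<^esub> g \<otimes>\<^bsub>G\<^esub> h \<in> S}\<rparr>"

lemma cayley_graph_simps [simp]:
  "pverts (cayley_graph G S) = carrier G"
  "(g, h) \<in> parcs (cayley_graph G S) \<longleftrightarrow>
     g \<in> carrier G \<and> h \<in> carrier G \<and> inv\<^bsub>G\<^esub> g \<otimes>\<^bsub>G\<^esub> h \<in> S"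
  by (simp_all add: cayley_graph_def)

lemma wf_cayley_graph: "wf_digraph (cayley_graph G S)"
  by unfold_locales (auto simp: cayley_graph_def)

lemma pair_graph_cayley_graph:
  fixes G (structure)
  assumes "group G" "finite (carrier G)" "connection_set G S"
  shows "pair_graph (cayley_graph G S)"
proof -
  interpret group G by fact
  show ?thesis
  proof unfold_locales
    show "finite (parcs (cayley_graph G S))"
      by (rule finite_subset[of _ "carrier G \<times> carrier G"]) (auto simp: assms(2))
    show "symmetric (cayley_graph G S)"
      unfolding symmetric_def
    proof (rule symI)
      fix g h assume "(g, h) \<in> arcs_ends (cayley_graph G S)"
      then have gh: "g \<in> carrier G" "h \<in> carrier G" "inv g \<otimes> h \<in> S" by auto
      then have "inv (inv g \<otimes> h) \<in> S" using assms(3) by (auto simp: connection_set_def)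
      then show "(h, g) \<in> arcs_ends (cayley_graph G S)"
        using gh by (simp add: inv_mult_group)
    qed
  qed (use assms(2,3) in \<open>auto simp: cayley_graph_def connection_set_def\<close>)
qed

lemma out_degree_cayley_graph:
  fixes G (structure)
  assumes "group G" "connection_set G S" "g \<in> carrier G"
  shows "out_degree (cayley_graph G S) g = card S"
proof -
  interpret group G by fact
  have S: "S \<subseteq> carrier G" using assms(2) by (simp add: connection_set_def)
  have "out_arcs (cayley_graph G S) g = (\<lambda>s. (g, g \<otimes> s)) ` S"
  proof (intro equalityI subsetI)
    fix e assume "e \<in> out_arcs (cayley_graph G S) g"
    then obtain h where "e = (g, h)" "h \<in> carrier G" "inv g \<otimes> h \<in> S"
      by (cases e) auto
    moreover have "h = g \<otimes> (inv g \<otimes> h)"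
      using assms(3) \<open>h \<in> carrier G\<close> by (simp add: m_assoc[symmetric])
    ultimately show "e \<in> (\<lambda>s. (g, g \<otimes> s)) ` S" by blast
  next
    fix e assume "e \<in> (\<lambda>s. (g, g \<otimes> s)) ` S"
    then show "e \<in> out_arcs (cayley_graph G S) g"
      using assms(3) S by (auto simp: m_assoc[symmetric] subset_iff)
  qed
  moreover have "inj_on (\<lambda>s. (g, g \<otimes> s)) S"
    using S assms(3) by (auto simp: inj_on_def subset_iff)
  ultimately show ?thesis by (simp add: out_degree_def card_image)
qed

text \<open>
  With unit arc weights, \<open>\<mu>\<close> is the usual distance, with value \<open>\<infinity>\<close> between different components.
\<close>

definition graph_diameter :: "('a, 'b) pre_digraph \<Rightarrow> ereal" where
  "graph_diameter \<Gamma> =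
     (SUP u \<in> verts \<Gamma>. SUP v \<in> verts \<Gamma>. wf_digraph.\<mu> \<Gamma> (\<lambda>_. 1) u v)"

text \<open>
  The groups range over the type \<^typ>\<open>nat\<close> only because HOL cannot quantify over types inside a
  definition; by \<open>abelian_cayley_ordersI\<close> below this is no restriction.
  Finiteness of \<open>G\<close> only rules out infinite \<open>S\<close>, whose \<open>card\<close> is 0: a Cayley graph of finite
  valency and finite diameter is finite.
  The maximum is over a finite set by \<open>finite_abelian_cayley_orders\<close>.
\<close>

definition abelian_cayley_orders :: "nat \<Rightarrow> nat \<Rightarrow> nat set" where
  "abelian_cayley_orders d k = {order G | (G :: nat monoid) S.
     comm_group G \<and> finite (carrier G) \<and> connection_set G S \<and> card S = d \<and>
     graph_diameter (cayley_graph G S) = ereal (real k)}"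

definition AC :: "nat \<Rightarrow> nat \<Rightarrow> nat" where
  "AC d k = Max (abelian_cayley_orders d k)"

lemma (in wf_digraph) awalk_cost_one: "awalk_cost (\<lambda>_. 1) p = real (length p)"
  by (induct p) auto

lemma (in wf_digraph) short_awalk:
  assumes "\<mu> (\<lambda>_. 1) u v \<le> ereal (real k)"
  obtains p where "awalk u p v" "length p \<le> k"
proof -
  have "\<mu> (\<lambda>_. 1) u v < ereal (real (Suc k))"
    using assms by (rule le_less_trans) simp
  then obtain p where "awalk u p v" "awalk_cost (\<lambda>_. 1) p < real (Suc k)"
    unfolding \<mu>_def INF_less_iff by auto
  then show thesis using that by (auto simp: awalk_cost_one simp del: of_nat_Suc)
qed

lemma cayley_awalk_endpoint:
  fixes G (structure)
  assumes "group G" "S \<subseteq> carrier G" "pre_digraph.awalk (cayley_graph G S) g p h"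
  shows "\<exists>xs. set xs \<subseteq> S \<and> length xs = length p \<and> h = foldl (\<otimes>\<^bsub>G\<^esub>) g xs"
  using assms(3)
proof (induct p arbitrary: g)
  interpret wf_digraph "cayley_graph G S" by (rule wf_cayley_graph)
  case Nil
  then show ?case by (simp add: awalk_Nil_iff)
next
  interpret wf_digraph "cayley_graph G S" by (rule wf_cayley_graph)
  interpret group G by fact
  case (Cons e p)
  obtain a b where e: "e = (a, b)" by fastforce
  with Cons(2) have *: "a = g" "g \<in> carrier G" "b \<in> carrier G" "inv g \<otimes> b \<in> S" "awalk b p h"
    by (auto simp: awalk_Cons_iff)
  obtain xs where "set xs \<subseteq> S" "length xs = length p" "h = foldl (\<otimes>) b xs"
    using Cons(1) *(5) by blast
  moreover have "g \<otimes> (inv g \<otimes> b) = b" using * by (simp add: m_assoc[symmetric])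
  ultimately show ?case using * by (intro exI[of _ "(inv g \<otimes> b) # xs"]) auto
qed

lemma cayley_order_bound:
  fixes G (structure)
  assumes "group G" "finite (carrier G)" "connection_set G S"
    and "graph_diameter (cayley_graph G S) = ereal (real k)"
  shows "order G \<le> (\<Sum>i\<le>k. card S ^ i)"
proof -
  interpret group G by fact
  interpret \<Gamma>: wf_digraph "cayley_graph G S" by (rule wf_cayley_graph)
  let ?L = "{xs. set xs \<subseteq> S \<and> length xs \<le> k}"
  have S: "S \<subseteq> carrier G" using assms(3) by (simp add: connection_set_def)
  then have "finite S" using assms(2) finite_subset by blast
  have "carrier G \<subseteq> foldl (\<otimes>) \<one> ` ?L"
  proof
    fix h assume h: "h \<in> carrier G"
    have "\<Gamma>.\<mu> (\<lambda>_. 1) \<one> h \<le> graph_diameter (cayley_graph G S)"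
      unfolding graph_diameter_def
      by (rule SUP_upper2[of \<one>], simp, rule SUP_upper2[of h]) (use h in simp_all)
    then have "\<Gamma>.\<mu> (\<lambda>_. 1) \<one> h \<le> ereal (real k)" by (simp only: assms(4))
    then obtain p where p: "\<Gamma>.awalk \<one> p h" "length p \<le> k"
      by (rule \<Gamma>.short_awalk)
    obtain xs where "set xs \<subseteq> S" "length xs = length p" "h = foldl (\<otimes>) \<one> xs"
      using cayley_awalk_endpoint[OF assms(1) S p(1)] by blast
    with p(2) show "h \<in> foldl (\<otimes>) \<one> ` ?L" by auto
  qed
  then have "order G \<le> card ?L"
    unfolding order_def using finite_lists_length_le[OF \<open>finite S\<close>]
    by (meson card_image_le card_mono finite_imageI order_trans)
  then show ?thesis using card_lists_length_le[OF \<open>finite S\<close>] by simp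
qed

lemma finite_abelian_cayley_orders: "finite (abelian_cayley_orders d k)"
proof (rule finite_subset)
  show "abelian_cayley_orders d k \<subseteq> {.. \<Sum>i\<le>k. d ^ i}"
  proof
    fix n assume "n \<in> abelian_cayley_orders d k"
    then obtain G :: "nat monoid" and S where n: "n = order G" and d: "card S = d"
      and G: "comm_group G" "finite (carrier G)" "connection_set G S"
        "graph_diameter (cayley_graph G S) = ereal (real k)"
      unfolding abelian_cayley_orders_def by blast
    have "order G \<le> (\<Sum>i\<le>k. card S ^ i)"
      by (rule cayley_order_bound) (use G comm_group.axioms(2) in blast)+
    then show "n \<in> {.. \<Sum>i\<le>k. d ^ i}" by (simp only: n d atMost_iff)
  qed
qed simp

lemma graph_diameter_app_iso_le:
  assumes "wf_digraph \<Gamma>" "pre_digraph.digraph_isomorphism \<Gamma> \<phi>"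
  shows "graph_diameter (app_iso \<phi> \<Gamma>) \<le> graph_diameter \<Gamma>"
proof -
  interpret wf_digraph \<Gamma> by fact
  interpret H: wf_digraph "app_iso \<phi> \<Gamma>" using assms(2) ..
  have "H.\<mu> (\<lambda>_. 1) (iso_verts \<phi> u) (iso_verts \<phi> v) \<le> \<mu> (\<lambda>_. 1) u v" for u v
    unfolding \<mu>_def[of _ u v]
  proof (rule INF_greatest, clarsimp)
    fix p assume "awalk u p v"
    from H.min_cost_le_walk_cost[OF awalk_app_isoI[OF this assms(2)], of "\<lambda>_. 1"]
    show "H.\<mu> (\<lambda>_. 1) (iso_verts \<phi> u) (iso_verts \<phi> v) \<le> ereal (awalk_cost (\<lambda>_. 1) p)"
      by (simp add: awalk_cost_one H.awalk_cost_one)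
  qed
  then show ?thesis
    unfolding graph_diameter_def by (auto intro!: SUP_mono simp: image_image)
qed

lemma graph_diameter_app_iso:
  assumes "wf_digraph \<Gamma>" "pre_digraph.digraph_isomorphism \<Gamma> \<phi>"
  shows "graph_diameter (app_iso \<phi> \<Gamma>) = graph_diameter \<Gamma>"
proof (rule antisym)
  interpret wf_digraph \<Gamma> by fact
  show "graph_diameter \<Gamma> \<le> graph_diameter (app_iso \<phi> \<Gamma>)"
    using graph_diameter_app_iso_le[OF wf_digraphI_app_iso[OF assms(2)] digraph_isomorphism_invI[OF assms(2)]]
    by (simp only: app_iso_inv[OF assms(2)])
qed (rule graph_diameter_app_iso_le[OF assms])

lemma cayley_graph_iso:
  fixes G (structure)
  assumes "group G" "group H" "f \<in> iso G H" "S \<subseteq> carrier G"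
  defines "\<phi> \<equiv> \<lparr>iso_verts = f, iso_arcs = map_prod f f, iso_head = snd, iso_tail = fst\<rparr>"
  shows "pre_digraph.digraph_isomorphism (cayley_graph G S) \<phi>"
    and "with_proj (cayley_graph H (f ` S)) = app_iso \<phi> (cayley_graph G S)"
proof -
  interpret group_hom G H f
    using assms by (auto simp: group_hom_def group_hom_axioms_def iso_def)
  have f: "inj_on f (carrier G)" "f ` carrier G = carrier H"
    using assms(3) by (auto simp: iso_def bij_betw_def)
  have "inj_on (map_prod f f) (parcs (cayley_graph G S))"
    by (rule inj_on_subset[OF map_prod_inj_on[OF f(1) f(1)]]) auto
  then show "pre_digraph.digraph_isomorphism (cayley_graph G S) \<phi>"
    using f wf_cayley_graph[of G S]
    by (auto simp: pre_digraph.digraph_isomorphism_def \<phi>_def)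
  have mem: "f x \<in> f ` S \<longleftrightarrow> x \<in> S" if "x \<in> carrier G" for x
    using that f(1) assms(4) by (auto dest: inj_onD)
  have arc: "(f a, f b) \<in> parcs (cayley_graph H (f ` S)) \<longleftrightarrow> (a, b) \<in> parcs (cayley_graph G S)"
    if "a \<in> carrier G" "b \<in> carrier G" for a b
    using that mem[of "inv a \<otimes> b"] by simp
  have "parcs (cayley_graph H (f ` S)) = map_prod f f ` parcs (cayley_graph G S)"
  proof (intro equalityI subsetI)
    fix e assume e: "e \<in> parcs (cayley_graph H (f ` S))"
    obtain x y where "e = (x, y)" by fastforce
    with e have "x \<in> f ` carrier G" "y \<in> f ` carrier G" using f(2) by auto
    then obtain a b where "e = (f a, f b)" "a \<in> carrier G" "b \<in> carrier G"
      using \<open>e = (x, y)\<close> by blast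
    with e arc show "e \<in> map_prod f f ` parcs (cayley_graph G S)"
      by (metis map_prod_imageI)
  next
    fix e assume "e \<in> map_prod f f ` parcs (cayley_graph G S)"
    then obtain a b where "e = (f a, f b)" and ab: "(a, b) \<in> parcs (cayley_graph G S)" by auto
    moreover from ab have "a \<in> carrier G" "b \<in> carrier G" by auto
    ultimately show "e \<in> parcs (cayley_graph H (f ` S))" using arc by blast
  qed
  then show "with_proj (cayley_graph H (f ` S)) = app_iso \<phi> (cayley_graph G S)"
    using f(2) by (simp add: with_proj_def app_iso_def \<phi>_def)
qed

lemma abelian_cayley_ordersI:
  fixes G :: "'a monoid" (structure)
  assumes "comm_group G" "finite (carrier G)" "connection_set G S" "card S = d"
    and "graph_diameter (cayley_graph G S) = ereal (real k)"
  shows "order G \<in> abelian_cayley_orders d k"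
proof -
  interpret comm_group G by fact
  obtain f :: "'a \<Rightarrow> nat" where inj: "inj_on f (carrier G)"
    using finite_imp_inj_to_nat_seg[OF assms(2)] by blast
  define H where "H = image_group f G"
  have f: "f \<in> iso G H"
    using inj by (auto simp: H_def iso_def hom_def image_group_def bij_betw_def)
  have cH: "carrier H = f ` carrier G" by (simp add: H_def image_group_def)
  have oH: "\<one>\<^bsub>H\<^esub> = f \<one>" by (simp add: H_def image_group_def)
  have mult: "f a \<otimes>\<^bsub>H\<^esub> f b = f (a \<otimes> b)" if "a \<in> carrier G" "b \<in> carrier G" for a b
    using inj that by (simp add: H_def image_group_def)
  have H: "comm_group H"
  proof (rule comm_groupI)
    fix x assume "x \<in> carrier H"
    then obtain a where "a \<in> carrier G" "x = f a" by (auto simp: cH)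
    then show "\<exists>y\<in>carrier H. y \<otimes>\<^bsub>H\<^esub> x = \<one>\<^bsub>H\<^esub>"
      by (intro bexI[of _ "f (inv a)"]) (simp_all add: cH oH mult)
  qed (auto simp: cH oH mult m_ac)
  then have gH: "group H" by (rule comm_group.axioms(2))
  interpret h: group_hom G H f
    using f gH is_group by (auto simp: group_hom_def group_hom_axioms_def iso_def)
  have S: "S \<subseteq> carrier G" "m_inv G ` S = S" "\<one> \<notin> S"
    using assms(3) by (auto simp: connection_set_def)
  have "m_inv H ` f ` S = f ` (m_inv G ` S)"
    unfolding image_image using S(1) by (intro image_cong) (auto simp: subset_iff)
  moreover have "f \<one> \<notin> f ` S"
    using inj_on_image_mem_iff[OF inj one_closed S(1)] S(3) by blast
  ultimately have "connection_set H (f ` S)"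
    using S by (auto simp: connection_set_def cH oH simp del: h.hom_one)
  moreover have "card (f ` S) = d"
    using assms(4) card_image[OF inj_on_subset[OF inj S(1)]] by simp
  moreover have "graph_diameter (cayley_graph H (f ` S)) = ereal (real k)"
    using graph_diameter_app_iso[OF wf_cayley_graph cayley_graph_iso(1)[OF is_group gH f S(1)]] assms(5)
    by (simp only: cayley_graph_iso(2)[OF is_group gH f S(1)])
  moreover have "finite (carrier H)" "order G = order H"
    using assms(2) inj by (simp_all add: cH order_def card_image)
  ultimately show ?thesis unfolding abelian_cayley_orders_def using H by blast
qed

end

theory Submission
  imports Defs "HOL-Algebra.Elementary_Groups" "HOL-Algebra.Algebraic_Closure_Type"
begin

text \<open>
  Let \<open>W = W\<^sub>2(F\<^sub>q)\<close>, the additive group of the Galois ring of order \<open>q\<^sup>2\<close> and characteristic 4, and let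
  \<open>T\<close> be its set of Teichmueller representatives. In \<open>W \<times> Z\<^sub>4\<close>, of order \<open>4 q\<^sup>2\<close>, take
  \<open>S = T \<times> {1} \<union> (- T) \<times> {3} \<union> 2W \<times> {2}\<close>, which has \<open>3 q\<close> elements. The classical relative
  difference set property says that \<open>T - T\<close> covers everything outside \<open>2W\<close>, and \<open>T\<close> is a transversal
  of \<open>2W\<close>, so the layers 0, 1 and 3 are covered by \<open>S + S\<close>. Layer 2 outside \<open>2W\<close> is covered by
  \<open>(T + T) \<union> (- T - T)\<close>: an element lies in \<open>T + T\<close> or in \<open>- T - T\<close> according to whether some
  \<open>c\<close> or \<open>c + 1\<close> has the form \<open>t\<^sup>2 + t\<close>, and one of the two happens because \<open>t\<^sup>2 + t + 1\<close> has no
  root in \<open>F\<^sub>q\<close> when \<open>m\<close> is odd.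
\<close>

section \<open>Cayley graphs of diameter two\<close>

lemma cayley_graph_diameter_eq_2:
  fixes G (structure)
  assumes "group G" "finite (carrier G)" "connection_set G S"
    and cover: "carrier G \<subseteq> insert \<one> S \<union> (S <#> S)" and small: "card S + 1 < Coset.order G"
  shows "graph_diameter (cayley_graph G S) = ereal (real 2)"
proof (rule antisym)
  interpret group G by fact
  interpret \<Gamma>: wf_digraph "cayley_graph G S" by (rule wf_cayley_graph)
  have S: "S \<subseteq> carrier G" using assms(3) by (simp add: connection_set_def)
  have "\<Gamma>.\<mu> (\<lambda>_. 1) u v \<le> ereal (real 2)" if u: "u \<in> carrier G" and v: "v \<in> carrier G" for u v
  proof -
    have eq: "u \<otimes> (inv u \<otimes> v) = v" using u v by (simp add: m_assoc[symmetric])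
    have "inv u \<otimes> v \<in> insert \<one> S \<union> (S <#> S)"
      using u v by (intro subsetD[OF cover]) simp
    then consider "inv u \<otimes> v = \<one>" | "inv u \<otimes> v \<in> S"
      | s t where "s \<in> S" "t \<in> S" "inv u \<otimes> v = s \<otimes> t"
      by (auto simp: set_mult_def)
    then obtain p where "\<Gamma>.awalk u p v" "length p \<le> 2"
    proof cases
      case 1
      then have "u = v" using eq u by simp
      then show thesis using u by (intro that[of "[]"]) (simp_all add: \<Gamma>.awalk_Nil_iff)
    next
      case 2
      then show thesis
        using u v by (intro that[of "[(u, v)]"]) (simp_all add: \<Gamma>.awalk_Cons_iff \<Gamma>.awalk_Nil_iff)
    next
      case 3
      with S have st: "s \<in> carrier G" "t \<in> carrier G" by auto
      \<comment> \<open>The walk goes through \<open>u \<otimes> s\<close>, from which right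
        multiplication by \<open>t\<close> leads to \<open>v\<close>.\<close>
      have "inv (u \<otimes> s) \<otimes> v = t"
        using st u v 3(3) by (simp add: inv_mult_group m_assoc) (simp add: m_assoc[symmetric])
      moreover have "inv u \<otimes> (u \<otimes> s) = s" using st u by (simp add: m_assoc[symmetric])
      ultimately show thesis
        using u v st 3 by (intro that[of "[(u, u \<otimes> s), (u \<otimes> s, v)]"])
          (simp_all add: \<Gamma>.awalk_Cons_iff \<Gamma>.awalk_Nil_iff)
    qed
    then have "\<Gamma>.\<mu> (\<lambda>_. 1) u v \<le> ereal (real (length p))"
      using \<Gamma>.min_cost_le_walk_cost[of u p v "\<lambda>_. 1"] by (simp add: \<Gamma>.awalk_cost_one)
    also have "\<dots> \<le> ereal (real 2)" using \<open>length p \<le> 2\<close> by simp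
    finally show ?thesis .
  qed
  then show "graph_diameter (cayley_graph G S) \<le> ereal (real 2)"
    unfolding graph_diameter_def by (auto intro!: SUP_least)
next
  interpret group G by fact
  interpret \<Gamma>: wf_digraph "cayley_graph G S" by (rule wf_cayley_graph)
  have S: "S \<subseteq> carrier G" using assms(3) by (simp add: connection_set_def)
  then have "finite (insert \<one> S)" using assms(2) finite_subset by auto
  then have "card (insert \<one> S) < card (carrier G)"
    using small by (simp add: Coset.order_def card_insert_if split: if_splits)
  \<comment> \<open>By counting, some \<open>h\<close> is neither the identity nor a neighbour of
    it, so no walk of length 0 or 1 reaches it.\<close>
  then obtain h where h: "h \<in> carrier G" "h \<noteq> \<one>" "h \<notin> S"
    using card_mono[OF \<open>finite (insert \<one> S)\<close>, of "carrier G"] by fastforce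
  have "ereal (real 2) \<le> \<Gamma>.\<mu> (\<lambda>_. 1) \<one> h"
    unfolding \<Gamma>.\<mu>_def
  proof (rule INF_greatest)
    fix p assume "p \<in> {p. \<Gamma>.awalk \<one> p h}"
    then have p: "\<Gamma>.awalk \<one> p h" by simp
    obtain xs where xs: "set xs \<subseteq> S" "length xs = length p" "h = foldl (\<otimes>) \<one> xs"
      using cayley_awalk_endpoint[OF assms(1) S p] by blast
    have "length xs \<ge> 2"
    proof (rule ccontr)
      assume "\<not> length xs \<ge> 2"
      then consider "xs = []" | x where "xs = [x]"
        by (cases xs; cases "tl xs") auto
      then show False using xs h S by cases (auto simp: subset_iff)
    qed
    then show "ereal (real 2) \<le> ereal (\<Gamma>.awalk_cost (\<lambda>_. 1) p)"
      by (simp add: \<Gamma>.awalk_cost_one xs(2))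
  qed
  also have "\<dots> \<le> graph_diameter (cayley_graph G S)"
    unfolding graph_diameter_def
    by (rule SUP_upper2[of \<one>], simp, rule SUP_upper2[of h]) (use h in simp_all)
  finally show "ereal (real 2) \<le> graph_diameter (cayley_graph G S)" .
qed

section \<open>Roots of separable polynomials\<close>

text \<open>Here \<open>p\<close> splits into linear factors, and a repeated one would make
  \<open>p\<close> and its derivative vanish together, so the multiset of roots is a set.\<close>

lemma card_roots_eq_degree:
  fixes p :: "'a :: alg_closed_field poly"
  assumes "p \<noteq> 0" "\<And>x. poly p x = 0 \<Longrightarrow> poly (pderiv p) x \<noteq> 0"
  shows "card {x. poly p x = 0} = degree p"
proof -
  obtain A where A: "size A = degree p" "p = smult (lead_coeff p) (\<Prod>x\<in>#A. [:-x, 1:])"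
    using alg_closed_imp_factorization[OF assms(1)] by blast
  have roots: "{x. poly p x = 0} = set_mset A"
    by (subst A(2)) (use assms(1) in \<open>auto simp: poly_prod_mset prod_mset_zero_iff\<close>)
  have "count A x = 1" if "x \<in># A" for x
  proof (rule ccontr)
    assume "count A x \<noteq> 1"
    moreover have "count A x > 0" using that by simp
    ultimately have "count A x \<ge> 2" by linarith
    then have "replicate_mset 2 x \<subseteq># A" by (simp add: count_le_replicate_mset_subset_eq[symmetric])
    then obtain B where B: "A = replicate_mset 2 x + B" by (metis subset_mset.le_iff_add)
    have "A = add_mset x (add_mset x B)" by (simp add: B numeral_2_eq_2)
    then have "p = smult (lead_coeff p) ([:-x, 1:] * ([:-x, 1:] * (\<Prod>y\<in>#B. [:-y, 1:])))"
      by (subst A(2)) (simp only: image_mset_add_mset prod_mset.add_mset)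
    then obtain r where r: "p = [:-x, 1:] * ([:-x, 1:] * r)"
      by (metis mult_smult_right)
    have "poly p x = 0" "poly (pderiv p) x = 0"
      by (simp_all add: r pderiv_mult del: mult_pCons_left)
    with assms(2) show False by blast
  qed
  then have "A = mset_set (set_mset A)"
    by (intro multiset_eqI) (auto simp: count_mset_set' not_in_iff)
  then show ?thesis using A(1) roots by (metis size_mset_set)
qed

section \<open>Witt vectors of length 2 and the connection set\<close>

text \<open>A set instead of a type, since the field with \<open>q\<close> elements will be cut out
  of an algebraic closure. Subtraction is addition in characteristic 2, so these conditions make
  \<open>F\<close> a subfield.\<close>

locale char_2_subfield =
  fixes F :: "'a :: field set"
  assumes char_2: "CHAR('a) = 2"
    and zero_mem [simp, intro]: "0 \<in> F" and one_mem [simp, intro]: "1 \<in> F"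
    and add_mem [simp, intro]: "x \<in> F \<Longrightarrow> y \<in> F \<Longrightarrow> x + y \<in> F"
    and mult_mem [simp, intro]: "x \<in> F \<Longrightarrow> y \<in> F \<Longrightarrow> x * y \<in> F"
    and divide_mem [simp, intro]: "x \<in> F \<Longrightarrow> y \<in> F \<Longrightarrow> x / y \<in> F"
begin

lemma two_eq_0: "(2 :: 'a) = 0"
  using of_nat_CHAR[where 'a = 'a] by (simp add: char_2)

lemma add_self [simp]: "x + x = (0 :: 'a)"
  by (metis two_eq_0 mult_2 mult_zero_left)

lemma add_self_left [simp]: "x + (x + y) = (y :: 'a)"
  by (simp add: add.assoc[symmetric])

lemma uminus_eq: "- x = (x :: 'a)"
  by (metis add_self add_eq_0_iff)

text \<open>
  The addition of Witt vectors of length 2 in characteristic 2; the pairs \<open>(x, 0)\<close> are the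
  Teichmueller representatives.
\<close>

definition witt_group :: "('a \<times> 'a) monoid" where
  "witt_group = \<lparr>carrier = F \<times> F, monoid.mult = (\<lambda>(a, b) (c, d). (a + c, b + d + a * c)), one = (0, 0)\<rparr>"

lemma witt_group_simps [simp]:
  "carrier witt_group = F \<times> F"
  "(a, b) \<otimes>\<^bsub>witt_group\<^esub> (c, d) = (a + c, b + d + a * c)"
  "\<one>\<^bsub>witt_group\<^esub> = (0, 0)"
  by (simp_all add: witt_group_def)

lemma comm_group_witt_group: "comm_group witt_group"
proof (rule comm_groupI)
  fix x assume "x \<in> carrier witt_group"
  then obtain a b where "x = (a, b)" "a \<in> F" "b \<in> F" by auto
  then show "\<exists>y\<in>carrier witt_group. y \<otimes>\<^bsub>witt_group\<^esub> x = \<one>\<^bsub>witt_group\<^esub>"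
    by (intro bexI[of _ "(a, b + a * a)"]) (simp_all add: ac_simps)
qed (auto simp: algebra_simps)

text \<open>Twice \<open>(a, b)\<close> is \<open>(0, a * a)\<close>, which is its own inverse, so
  adding it to \<open>(a, b)\<close> negates \<open>(a, b)\<close>.\<close>

lemma inv_witt_group [simp]:
  assumes "a \<in> F" "b \<in> F"
  shows "inv\<^bsub>witt_group\<^esub> (a, b) = (a, b + a * a)"
proof -
  interpret comm_group witt_group by (rule comm_group_witt_group)
  show ?thesis using assms by (intro inv_equality) (simp_all add: ac_simps)
qed

definition witt_cyclic_group :: "(('a \<times> 'a) \<times> int) monoid" where
  "witt_cyclic_group = witt_group \<times>\<times> integer_mod_group 4"

text \<open>The pairs \<open>(x, x * x)\<close> are the negatives of the Teichmueller
  representatives. The pairs \<open>(0, b)\<close> form \<open>2W\<close> when \<open>F\<close> is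
  finite, since squaring is then onto.\<close>

definition witt_connection_set :: "(('a \<times> 'a) \<times> int) set" where
  "witt_connection_set =
     (\<lambda>x. ((x, 0), 1)) ` F \<union> (\<lambda>x. ((x, x * x), 3)) ` F \<union> (\<lambda>b. ((0, b), 2)) ` F"

lemma witt_connection_setI [intro]:
  assumes "x \<in> F"
  shows "((x, 0), 1) \<in> witt_connection_set" "((x, x * x), 3) \<in> witt_connection_set"
    "((0, x), 2) \<in> witt_connection_set"
  using assms by (auto simp: witt_connection_set_def)

lemma comm_group_witt_cyclic_group: "comm_group witt_cyclic_group"
proof -
  interpret W: comm_group witt_group by (rule comm_group_witt_group)
  interpret Z: comm_group "integer_mod_group 4" by (rule abelian_integer_mod_group)
  interpret group witt_cyclic_group
    unfolding witt_cyclic_group_def by (rule DirProd_group) (fact W.is_group Z.is_group)+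
  show ?thesis
    by (rule group_comm_groupI)
      (auto simp: witt_cyclic_group_def add.commute mult.commute carrier_integer_mod_group)
qed

lemma order_witt_cyclic_group: "Coset.order witt_cyclic_group = 4 * card F ^ 2"
  by (simp add: Coset.order_def witt_cyclic_group_def carrier_integer_mod_group card_cartesian_product
      power2_eq_square)

text \<open>Inversion swaps the layers 1 and 3 and fixes layer 2 pointwise.\<close>

lemma connection_set_witt: "connection_set witt_cyclic_group witt_connection_set"
proof -
  have inv: "inv\<^bsub>witt_cyclic_group\<^esub> ((a, b), c) = ((a, b + a * a), (- c) mod 4)"
    if "a \<in> F" "b \<in> F" "c \<in> {0..<4}" for a b c
    using that unfolding witt_cyclic_group_def
    by (subst inv_DirProd)
      (simp_all add: comm_group_witt_group comm_group.axioms(2) carrier_integer_mod_group)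
  have "m_inv witt_cyclic_group ` witt_connection_set = witt_connection_set"
    unfolding witt_connection_set_def image_Un image_image by (simp add: inv cong: image_cong) blast
  then show ?thesis
    by (auto simp: connection_set_def witt_connection_set_def witt_cyclic_group_def
        carrier_integer_mod_group)
qed

lemma card_witt_connection_set:
  assumes "finite F"
  shows "card witt_connection_set = 3 * card F"
  unfolding witt_connection_set_def using assms
  by (subst card_Un_disjoint; (subst card_Un_disjoint)?) (auto simp: card_image inj_on_def)

section \<open>Covering the group by sums of two generators\<close>

text \<open>
  Without primitive cube roots of unity, 1 lies outside the image of \<open>t \<mapsto> t\<^sup>2 + t\<close>, a subgroup of
  index 2.
\<close>

lemma artin_schreier_dichotomy:
  assumes "finite F" and no_root: "\<And>x. x \<in> F \<Longrightarrow> x * x + x + 1 \<noteq> 0" and "c \<in> F"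
  obtains t where "t \<in> F" "t * t + t = c \<or> t * t + t = c + 1"
proof -
  define g where "g = (\<lambda>t :: 'a. t * t + t)"
  define s where "s = inv_into F g"
  have g: "g (t + u) = g t + g u" for t u
  proof -
    have "t * u + (t * u + y) = y" for y by simp
    then show ?thesis by (simp add: g_def algebra_simps)
  qed
  have g_mem: "g ` F \<subseteq> F" by (auto simp: g_def)
  have fin: "finite (g ` F)" using assms(1) by simp
  \<comment> \<open>The additive map \<open>g\<close> vanishes only at 0 and 1, so its fibres have
    at most two elements and its image contains at least half of \<open>F\<close>.\<close>
  have sub: "F \<subseteq> s ` g ` F \<union> (\<lambda>y. s y + 1) ` g ` F"
  proof
    fix t assume t: "t \<in> F"
    then have "g (s (g t)) = g t" unfolding s_def by (simp add: f_inv_into_f)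
    then have "g (t + s (g t)) = 0" by (simp add: g)
    then have "(t + s (g t)) * (t + s (g t) + 1) = 0" by (simp add: g_def algebra_simps)
    then have "t + s (g t) = 0 \<or> t + s (g t) + 1 = 0" by simp
    then have "t = s (g t) \<or> t = s (g t) + 1"
      by (auto simp: uminus_eq add_eq_0_iff add.assoc)
    then show "t \<in> s ` g ` F \<union> (\<lambda>y. s y + 1) ` g ` F" using t by blast
  qed
  have disj: "g ` F \<inter> (\<lambda>y. y + 1) ` g ` F = {}"
  proof (rule ccontr)
    assume "g ` F \<inter> (\<lambda>y. y + 1) ` g ` F \<noteq> {}"
    then obtain t u where "t \<in> F" "u \<in> F" "g t = g u + 1" by auto
    then have "g (t + u) + 1 = 0" by (simp add: g ac_simps)
    then show False using no_root[of "t + u"] \<open>t \<in> F\<close> \<open>u \<in> F\<close> by (simp add: g_def)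
  qed
  have "card F \<le> card (g ` F) + card (g ` F)"
    using card_mono[OF _ sub] card_Un_le[of "s ` g ` F" "(\<lambda>y. s y + 1) ` g ` F"]
      card_image_le[OF fin, of s] card_image_le[OF fin, of "\<lambda>y. s y + 1"] fin by simp
  also have "\<dots> = card (g ` F \<union> (\<lambda>y. y + 1) ` g ` F)"
    using fin disj by (subst card_Un_disjoint) (auto simp: card_image)
  finally have "g ` F \<union> (\<lambda>y. y + 1) ` g ` F = F"
    using assms(1) g_mem by (intro card_seteq) auto
  then consider t where "t \<in> F" "c = g t" | t where "t \<in> F" "c = g t + 1"
    using assms(3) by blast
  then show thesis by cases (auto intro!: that simp: g_def add.assoc)
qed

lemma witt_cyclic_group_cover:
  assumes "finite F" and no_root: "\<And>x. x \<in> F \<Longrightarrow> x * x + x + 1 \<noteq> 0"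
  shows "carrier witt_cyclic_group \<subseteq>
    insert \<one>\<^bsub>witt_cyclic_group\<^esub> witt_connection_set \<union>
    (witt_connection_set <#>\<^bsub>witt_cyclic_group\<^esub> witt_connection_set)"
proof
  let ?G = witt_cyclic_group and ?S = witt_connection_set
  have mult: "((a, b), i) \<otimes>\<^bsub>?G\<^esub> ((c, d), j) = ((a + c, b + d + a * c), (i + j) mod 4)" for a b c d i j
    by (simp add: witt_cyclic_group_def)
  have prod: "g \<in> ?S <#>\<^bsub>?G\<^esub> ?S" if "s \<in> ?S" "t \<in> ?S" "g = s \<otimes>\<^bsub>?G\<^esub> t" for g s t
    using that by (auto simp: set_mult_def)
  fix g assume "g \<in> carrier ?G"
  then obtain a b k where g: "g = ((a, b), k)" and ab: "a \<in> F" "b \<in> F" and k: "k \<in> {0..<4}"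
    by (auto simp: witt_cyclic_group_def carrier_integer_mod_group)
  from k consider "k = 0" "a = 0" | "k = 0" "a \<noteq> 0" | "k = 1" | "k = 2" "a = 0" | "k = 2" "a \<noteq> 0" | "k = 3"
    by force
  then show "g \<in> insert \<one>\<^bsub>?G\<^esub> ?S \<union> (?S <#>\<^bsub>?G\<^esub> ?S)"
  proof cases
    case 1
    have "g \<in> ?S <#>\<^bsub>?G\<^esub> ?S"
      by (rule prod[of "((0, b), 2)" "((0, 0), 2)"]) (use 1 ab in \<open>auto simp: mult g\<close>)
    then show ?thesis by simp
  next
    case 2
    \<comment> \<open>The difference of the representatives of \<open>a + y\<close> and
      \<open>y\<close> is \<open>(a, a * y)\<close>.\<close>
    define y where "y = b / a"
    have y: "y \<in> F" "b = a * y" using 2 ab by (auto simp: y_def)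
    have "g \<in> ?S <#>\<^bsub>?G\<^esub> ?S"
      by (rule prod[of "((a + y, 0), 1)" "((y, y * y), 3)"])
        (use 2 ab y in \<open>auto simp: mult g algebra_simps\<close>)
    then show ?thesis by simp
  next
    case 3
    have "g \<in> ?S <#>\<^bsub>?G\<^esub> ?S"
      by (rule prod[of "((a, a * a), 3)" "((0, b + a * a), 2)"])
        (use 3 ab in \<open>auto simp: mult g ac_simps\<close>)
    then show ?thesis by simp
  next
    case 4
    then show ?thesis using ab by (auto simp: g)
  next
    case 5
    \<comment> \<open>With \<open>x = a * t\<close>, the representatives of \<open>x\<close> and
      \<open>a + x\<close> sum to \<open>(a, a * a * (t * t + t))\<close>. Their negatives sum to
      the same pair with \<open>a * a\<close> added to the second coordinate, hence the shift by 1
      in the second alternative.\<close>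
    have "b / (a * a) \<in> F" using ab by simp
    then obtain t where t: "t \<in> F" "t * t + t = b / (a * a) \<or> t * t + t = b / (a * a) + 1"
      using artin_schreier_dichotomy[OF assms] by blast
    define x where "x = a * t"
    have x: "x \<in> F" using ab t by (simp add: x_def)
    have xt: "x * (a + x) = a * a * (t * t + t)" by (simp add: x_def algebra_simps)
    from t(2) have "g \<in> ?S <#>\<^bsub>?G\<^esub> ?S"
    proof
      assume "t * t + t = b / (a * a)"
      then have "x * (a + x) = b" using 5 unfolding xt by simp
      then show ?thesis
        by (intro prod[of "((x, 0), 1)" "((a + x, 0), 1)"])
          (use 5 ab x in \<open>auto simp: mult g ac_simps\<close>)
    next
      assume "t * t + t = b / (a * a) + 1"
      then have "x * (a + x) = b + a * a" using 5 unfolding xt by (simp add: algebra_simps)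
      then have b: "b = a * a + x * (a + x)" by (simp add: ac_simps)
      have "x * x + (a + x) * (a + x) + x * (a + x) = b"
      proof -
        have "a * x + (a * x + y) = y" for y by simp
        then show ?thesis unfolding b by (simp add: algebra_simps)
      qed
      then show ?thesis
        by (intro prod[of "((x, x * x), 3)" "((a + x, (a + x) * (a + x)), 3)"])
          (use 5 ab x in \<open>auto simp: mult g ac_simps\<close>)
    qed
    then show ?thesis by simp
  next
    case 6
    have "g \<in> ?S <#>\<^bsub>?G\<^esub> ?S"
      by (rule prod[of "((a, 0), 1)" "((0, b), 2)"]) (use 6 ab in \<open>auto simp: mult g\<close>)
    then show ?thesis by simp
  qed
qed

lemma mem_abelian_cayley_orders:
  assumes "finite F" and "\<And>x. x \<in> F \<Longrightarrow> x * x + x + 1 \<noteq> 0"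
  shows "4 * card F ^ 2 \<in> abelian_cayley_orders (3 * card F) 2"
proof -
  have fin: "finite (carrier witt_cyclic_group)"
    using assms(1) by (simp add: witt_cyclic_group_def carrier_integer_mod_group)
  have "{0, 1} \<subseteq> F" by auto
  then have "2 \<le> card F" using card_mono[OF assms(1), of "{0, 1}"] by simp
  moreover from this have "2 * card F \<le> card F ^ 2" by (simp add: power2_eq_square)
  ultimately have "card witt_connection_set + 1 < Coset.order witt_cyclic_group"
    unfolding order_witt_cyclic_group card_witt_connection_set[OF assms(1)] by linarith
  then have "graph_diameter (cayley_graph witt_cyclic_group witt_connection_set) = ereal (real 2)"
    using comm_group.axioms(2)[OF comm_group_witt_cyclic_group] fin connection_set_witt
      witt_cyclic_group_cover[OF assms] by (rule cayley_graph_diameter_eq_2[rotated -1])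
  then show ?thesis
    using abelian_cayley_ordersI[OF comm_group_witt_cyclic_group fin connection_set_witt
      card_witt_connection_set[OF assms(1)]] by (simp add: order_witt_cyclic_group)
qed

end

section \<open>The field with \<open>2 ^ m\<close> elements as a Frobenius fixed field\<close>

definition frobenius_fixed :: "nat \<Rightarrow> gf2 alg_closure set" where
  "frobenius_fixed m = {x. x ^ 2 ^ m = x}"

lemma CHAR_gf2 [simp]: "CHAR(gf2) = 2"
proof (rule CHAR_eq_posI)
  have "1 + 1 = (0 :: gf2)" by transfer simp
  then show "of_nat 2 = (0 :: gf2)" by simp
next
  fix x :: nat assume "x > 0" "x < 2"
  then have "x = 1" by simp
  then show "of_nat x \<noteq> (0 :: gf2)" by simp
qed simp

lemma char_2_subfield_frobenius_fixed: "char_2_subfield (frobenius_fixed m)"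
proof
  show char: "CHAR(gf2 alg_closure) = 2" by simp
  fix x y assume "x \<in> frobenius_fixed m" "y \<in> frobenius_fixed m"
  then show "x + y \<in> frobenius_fixed m" "x * y \<in> frobenius_fixed m" "x / y \<in> frobenius_fixed m"
    using freshmans_dream'[where 'a = "gf2 alg_closure", of "2 ^ m" m x y]
    by (simp_all add: frobenius_fixed_def power_mult_distrib power_divide)
qed (simp_all add: frobenius_fixed_def power_0_left)

text \<open>The polynomial defining the fixed points has derivative -1, because 2 = 0, so all its
  roots are simple.\<close>

lemma card_frobenius_fixed:
  assumes "m > 0"
  shows "card (frobenius_fixed m) = 2 ^ m"
proof -
  define p :: "gf2 alg_closure poly" where "p = monom 1 (2 ^ m) + [:0, -1:]"
  have two: "(2 :: gf2 alg_closure) = 0"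
    using of_nat_CHAR[where 'a = "gf2 alg_closure"] by (simp del: of_nat_CHAR)
  have "pderiv p = -1"
    using assms two by (simp add: p_def pderiv_add pderiv_monom pderiv_pCons power_0_left one_pCons)
  moreover have deg: "degree p = 2 ^ m"
  proof -
    have "(1 :: nat) < 2 ^ m" using assms by (intro one_less_power) simp_all
    then show ?thesis unfolding p_def by (subst degree_add_eq_left) (simp_all add: degree_monom_eq)
  qed
  moreover from deg have "p \<noteq> 0" by auto
  moreover have "frobenius_fixed m = {x. poly p x = 0}"
    by (simp add: frobenius_fixed_def p_def poly_monom)
  ultimately show ?thesis using card_roots_eq_degree[of p] by simp
qed

text \<open>A root satisfies \<open>x ^ 4 = x\<close>, so an odd power of Frobenius acts on it as
  squaring. Being fixed then means \<open>x ^ 2 = x\<close>, against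
  \<open>x * x = x + 1\<close>.\<close>

lemma no_cube_root_of_unity_frobenius_fixed:
  assumes "odd m" "x \<in> frobenius_fixed m"
  shows "x * x + x + 1 \<noteq> 0"
proof
  interpret char_2_subfield "frobenius_fixed m" by (rule char_2_subfield_frobenius_fixed)
  assume "x * x + x + 1 = 0"
  then have sq: "x * x = x + 1" by (simp add: add_eq_0_iff uminus_eq add.assoc)
  have "x ^ 4 = (x * x) * (x * x)" by (simp add: power4_eq_xxxx mult.assoc)
  also have "\<dots> = (x + 1) * (x + 1)" by (simp only: sq)
  also have "\<dots> = x * x + 1" by (simp add: distrib_left distrib_right add.assoc)
  also have "\<dots> = x" by (simp add: sq add.assoc)
  finally have "x ^ 4 = x" .
  then have four: "x ^ 4 ^ j = x" for j
    by (induction j) (simp_all add: power_mult)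
  obtain j where "m = 2 * j + 1" using assms(1) by (elim oddE)
  then have "(2 :: nat) ^ m = 4 ^ j * 2" by (simp add: power_mult)
  then have "x = x ^ 2" using assms(2) four[of j] by (simp add: frobenius_fixed_def power_mult)
  then show False using sq by (simp add: power2_eq_square)
qed

theorem theorem3p6:
  fixes m q d :: nat
  assumes "odd m" and "q = 2 ^ m" and "d = 3 * q"
  shows "real (AC d 2) \<ge> 4 / 9 * (real d)\<^sup>2"
proof -
  interpret char_2_subfield "frobenius_fixed m" by (rule char_2_subfield_frobenius_fixed)
  have card: "card (frobenius_fixed m) = q"
    using assms card_frobenius_fixed[of m] by (simp add: odd_pos)
  \<comment> \<open>An infinite set has \<open>card\<close> 0, but \<open>q\<close> is
    nonzero.\<close>
  then have "finite (frobenius_fixed m)" using assms(2) by (metis card.infinite power_not_zero zero_neq_numeral)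
  then have "4 * q ^ 2 \<in> abelian_cayley_orders d 2"
    using mem_abelian_cayley_orders no_cube_root_of_unity_frobenius_fixed[OF assms(1)]
    by (simp add: card assms(3))
  then have "4 * q ^ 2 \<le> AC d 2"
    unfolding AC_def using finite_abelian_cayley_orders by (intro Max_ge)
  then have "real (4 * q ^ 2) \<le> real (AC d 2)" by (simp only: of_nat_le_iff)
  then show ?thesis by (simp add: assms(3) power2_eq_square)
qed

end
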